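(* For each integer $d \geq 1$, there exists a lattice polytope $P \subseteq [0,3]^{6d} \subseteq \mathbb{R}^{6d}$ whose monotone diameter is at least $2^{d}-1$.
   Context: A lattice polytope in $\mathbb{R}^n$ is a polytope (convex hull of finitely many points) all of whose vertices lie in $\mathbb{Z}^n$. The graph of a polytope $P$ has the vertices of $P$ as nodes and the edges (1-dimensional faces) of $P$ as edges. A linear objective $\mathbf{c} \in \mathbb{R}^n$ induces an orientation of this graph: an edge between vertices $\mathbf{u}$ and $\mathbf{w}$ is directed from $\mathbf{u}$ to $\mathbf{w}$ if $\mathbf{c}^{\intercal}\mathbf{u} < \mathbf{c}^{\intercal}\mathbf{w}$ (so directed paths are paths along which $\mathbf{c}$ strictly increases). A sink is a vertex maximizing $\mathbf{c}$ over $P$. The monotone diameter of $P$ is the maximum distance to a sink across all orientations of its graph induced by a linear objective function, i.e. the maximum, over all linear objectives $\mathbf{c}$ and all starting vertices $\mathbf{u}$ of $P$, of the minimum number of edges in a $\mathbf{c}$-increasing path in the graph of $P$ from $\mathbf{u}$ to a vertex of $P$ maximizing $\mathbf{c}$. *)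

theory Defs
  imports "HOL-Analysis.Analysis" "HOL-Library.Extended_Nat"
begin

definition lattice_polytope :: "(real ^ 'n) set \<Rightarrow> bool" where
  "lattice_polytope P \<longleftrightarrow>
     polytope P \<and> (\<forall>v. v extreme_point_of P \<longrightarrow> (\<forall>i. v $ i \<in> \<int>))"

definition polytope_vertices :: "'a::euclidean_space set \<Rightarrow> 'a set" where
  "polytope_vertices P = {v. v extreme_point_of P}"

text \<open>The graph of a polytope, given by its symmetric adjacency relation on the vertices.\<close>

definition polytope_graph :: "'a::euclidean_space set \<Rightarrow> ('a \<times> 'a) set" where
  "polytope_graph P =
     {(u, w). u \<in> polytope_vertices P \<and> w \<in> polytope_vertices P \<and>
              closed_segment u w edge_of P}"

text \<open>Edges on which the objective is constant receive no direction, so a directed path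
  strictly increases the objective; this makes sense for every objective, generic or not.\<close>

definition induced_orientation :: "'a::euclidean_space set \<Rightarrow> 'a \<Rightarrow> ('a \<times> 'a) set" where
  "induced_orientation P c = {(u, w) \<in> polytope_graph P. c \<bullet> u < c \<bullet> w}"

definition sinks :: "'a::euclidean_space set \<Rightarrow> 'a \<Rightarrow> 'a set" where
  "sinks P c = {w \<in> polytope_vertices P. \<forall>x\<in>P. c \<bullet> x \<le> c \<bullet> w}"

text \<open>The power \<open>induced_orientation P c ^^ k\<close> relates \<open>u\<close> to \<open>w\<close> iff there is a directed walk
  with \<open>k\<close> edges from \<open>u\<close> to \<open>w\<close>; as the objective strictly increases, such walks are paths.
  Every vertex of a polytope has such a path to a sink (each vertex that is not a maximizer
  has a strictly improving neighbour), so for a polytope the infimum is never taken over the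
  empty set and the value is finite.\<close>

definition monotone_distance :: "'a::euclidean_space set \<Rightarrow> 'a \<Rightarrow> 'a \<Rightarrow> enat" where
  "monotone_distance P c u =
     (INF k \<in> {k. \<exists>w \<in> sinks P c. (u, w) \<in> induced_orientation P c ^^ k}. enat k)"

text \<open>For a polytope the distances are bounded by the number of vertices, so the supremum
  is a maximum.\<close>

definition monotone_diameter :: "'a::euclidean_space set \<Rightarrow> enat" where
  "monotone_diameter P = (SUP c. SUP u \<in> polytope_vertices P. monotone_distance P c u)"

end

theory Submission imports Defs begin

text \<open>
  The polytope is built around a chain of lattice points \<open>x 0, \<dots>, x N\<close> with \<open>N = 2 ^ d - 1\<close>. The
  coordinates of \<open>x i\<close> list the \<open>d\<close> binary digits of \<open>i\<close> and the \<open>2 * d\<close> binary digits of \<open>i\<^sup>2\<close>,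
  each digit written twice and increased by \<open>1\<close>, so that all entries are \<open>1\<close> or \<open>2\<close>. Weighting
  digits by powers of two gives linear functionals \<open>c\<close> and \<open>g\<close> which, up to an affine change of
  scale, take the values \<open>i\<close> and \<open>i\<^sup>2\<close> at \<open>x i\<close>: the chain projects to points on a parabola.

  By itself the convex hull of the chain may have many edges that jump far ahead. They are destroyed
  by adding the translates \<open>x i + q\<close> of the chain by a set \<open>Q\<close> of directions with \<open>c \<bullet> q = 0\<close> and
  \<open>g \<bullet> q > 0\<close>, that is, directions which lead straight into the inside of the parabola. Let
  \<open>x l\<close> and \<open>s\<close> be the ends of an edge along which \<open>c\<close> increases.
  \<^item> If \<open>s = x j + q\<close>, then \<open>x l + s = x j + (x l + q)\<close>.
  \<^item> If \<open>s = x (Suc p)\<close> with \<open>l < p\<close>, suppose that \<open>Q\<close> contains \<open>q\<close>, \<open>q'\<close> whose sum is the second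
    difference \<open>(x (Suc p) - x p) - (x (Suc l) - x l)\<close>. Then
    \<open>3 x l + s = x (Suc l) + x p + (x l + q) + (x l + q')\<close>.

  In both cases an inner point of the edge is an average of points of the polytope, one of them
  \<open>x l + q\<close>, so \<open>x l + q\<close> lies on the edge; this is impossible, as \<open>c\<close> has the same value there as at
  \<open>x l\<close> and \<open>q\<close> is not zero. Hence the only improving edge at \<open>x l\<close> can be the one to \<open>x (Suc l)\<close>
  (\<open>improving_edge_is_next_step\<close>), and a monotone path from \<open>x 0\<close>, which is a vertex because it is
  the unique minimizer of \<open>g\<close>, has to climb the chain one point at a time
  (\<open>monotone_diameter_chain\<close>).

  It remains to find \<open>Q\<close> inside \<open>{-1, 0, 1}\<^sup>6\<^sup>d\<close>, so that \<open>x i + q\<close> has entries between \<open>0\<close> and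
  \<open>3\<close>. A second difference of the chain has entries between \<open>-2\<close> and \<open>2\<close>, and \<open>c\<close> vanishes on it
  while \<open>g\<close> is positive on it, by convexity of the square. Since each digit occurs twice, it is the
  sum of two integer vectors on which \<open>c\<close> and \<open>g\<close> take exactly half of its values: one rounds half
  of the entry down at the first copy of a digit and up at the second copy, and the other rounds the
  opposite way.
\<close>

section \<open>Monotone paths along a chain with pushed copies\<close>

lemma face_of_mem_of_combination:
  assumes "T face_of P" "a \<in> P" "b \<in> P" "0 < u" "u < 1"
    and "(1 - u) *\<^sub>R a + u *\<^sub>R b \<in> T"
  shows "a \<in> T"
proof (cases "a = b")
  case True
  then show ?thesis using assms(6) by (simp add: algebra_simps)
next
  case False
  then have "(1 - u) *\<^sub>R a + u *\<^sub>R b \<in> open_segment a b"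
    using assms by (auto simp: in_segment)
  then show ?thesis using assms by (auto simp: face_of_def)
qed

lemma level_direction_in_segment:
  fixes a q s c :: "'a::real_inner"
  assumes "a + q \<in> closed_segment a s" "c \<bullet> q = 0" "c \<bullet> a < c \<bullet> s"
  shows "q = 0"
proof -
  obtain u where u: "a + q = (1 - u) *\<^sub>R a + u *\<^sub>R s"
    using assms(1) by (auto simp: in_segment)
  then have q: "q = u *\<^sub>R (s - a)" by (simp add: algebra_simps)
  then have "u * (c \<bullet> s - c \<bullet> a) = 0" using assms(2) by (simp add: inner_diff_right)
  then show ?thesis using assms(3) q by simp
qed

text \<open>
  For a polytope spanned by a chain \<open>x\<close>, the translates by \<open>Q\<close> serve to cover the inner points of
  all segments that would be shortcuts.
\<close>
definition chain_with_pushes :: "(nat \<Rightarrow> 'a::real_vector) \<Rightarrow> nat \<Rightarrow> 'a set \<Rightarrow> 'a set" where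
  "chain_with_pushes x N Q = x ` {..N} \<union> (\<lambda>(i, q). x i + q) ` ({..N} \<times> Q)"

text \<open>
  Any relation that puts an inner point of the edge into the open segment from some \<open>x l + q\<close> to
  another point of the polytope is contradictory, because the edge meets the level of \<open>c\<close> through
  \<open>x l\<close> only in \<open>x l\<close>. The hypothesis \<open>short\<close> supplies such a relation for every step that skips a
  point of the chain.
\<close>
lemma improving_edge_is_next_step:
  fixes x :: "nat \<Rightarrow> 'a::euclidean_space"
  assumes mono: "\<And>i j. i < j \<Longrightarrow> j \<le> N \<Longrightarrow> c \<bullet> x i < c \<bullet> x j"
    and level: "\<And>q. q \<in> Q \<Longrightarrow> c \<bullet> q = 0 \<and> q \<noteq> 0"
    and short: "\<And>l j. l < j \<Longrightarrow> Suc j \<le> N \<Longrightarrow>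
          \<exists>q\<in>Q. \<exists>q'\<in>Q. q + q' = (x (Suc j) - x j) - (x (Suc l) - x l)"
    and l: "l \<le> N" and s: "s \<in> chain_with_pushes x N Q" and up: "c \<bullet> x l < c \<bullet> s"
    and edge: "closed_segment (x l) s edge_of convex hull (chain_with_pushes x N Q)"
  shows "Suc l \<le> N \<and> s = x (Suc l)"
proof -
  let ?P = "convex hull (chain_with_pushes x N Q)"
  have face: "closed_segment (x l) s face_of ?P" using edge by (simp add: edge_of_def)
  have xP: "x i \<in> ?P" if "i \<le> N" for i
    using that by (auto intro!: hull_inc simp: chain_with_pushes_def)
  have qP: "x i + q \<in> ?P" if "i \<le> N" "q \<in> Q" for i q
    using that by (force intro!: hull_inc simp: chain_with_pushes_def)
  have no_push: False
    if "q \<in> Q" "b \<in> ?P" "0 < u" "u < 1"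
      "(1 - u) *\<^sub>R (x l + q) + u *\<^sub>R b \<in> closed_segment (x l) s" for q b and u :: real
    using level_direction_in_segment[of "x l" q s c] level[OF that(1)] up
      face_of_mem_of_combination[OF face qP[OF l that(1)] that(2-5)] by auto
  from s consider j where "j \<le> N" "s = x j" | j q where "j \<le> N" "q \<in> Q" "s = x j + q"
    by (auto simp: chain_with_pushes_def)
  then show ?thesis
  proof cases
    case 2
    have "(1 - 1/2) *\<^sub>R (x l + q) + (1/2) *\<^sub>R x j = (1 - 1/2) *\<^sub>R x l + (1/2::real) *\<^sub>R s"
      using 2 by (simp add: algebra_simps)
    also have "\<dots> \<in> closed_segment (x l) s" unfolding in_segment by (intro exI[of _ "1/2"]) simp
    finally show ?thesis using no_push[OF 2(2) xP[OF 2(1)], of "1/2"] by simp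
  next
    case 1
    then have "l < j" using up mono[of j l] l by (cases l j rule: linorder_cases) auto
    show ?thesis
    proof (cases "j = Suc l")
      case True
      then show ?thesis using 1 by simp
    next
      case False
      define p where "p = j - 1"
      have p: "l < p" "j = Suc p" using False \<open>l < j\<close> by (auto simp: p_def)
      obtain q q' where q: "q \<in> Q" "q' \<in> Q" "q + q' = (x j - x p) - (x (Suc l) - x l)"
        using short[of l p] p 1 by auto
      \<comment> \<open>\<open>b\<close> is the centroid of \<open>x (Suc l)\<close>, \<open>x p\<close> and \<open>x l + q'\<close>; with \<open>x l + q\<close> at weight \<open>1/4\<close> it
        averages to the point a quarter of the way from \<open>x l\<close> to \<open>x j\<close>.\<close>
      define m where "m = (1/2) *\<^sub>R x (Suc l) + (1/2::real) *\<^sub>R x p"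
      define b where "b = (2/3) *\<^sub>R m + (1/3::real) *\<^sub>R (x l + q')"
      have "m \<in> ?P"
        unfolding m_def using xP[of "Suc l"] xP[of p] p 1
        by (intro convexD[OF convex_convex_hull]) auto
      then have bP: "b \<in> ?P"
        unfolding b_def using qP[OF l q(2)] by (intro convexD[OF convex_convex_hull]) auto
      have "(1 - 3/4) *\<^sub>R (x l + q) + (3/4) *\<^sub>R b
          = (1/4::real) *\<^sub>R (2 *\<^sub>R x l + (q + q') + x (Suc l) + x p)"
        by (simp add: b_def m_def algebra_simps flip: scaleR_add_left)
      also have "2 *\<^sub>R x l + (q + q') + x (Suc l) + x p = 3 *\<^sub>R x l + x j"
        unfolding q(3) using scaleR_add_left[of 1 2 "x l"] by (simp add: algebra_simps scaleR_2)
      also have "(1/4::real) *\<^sub>R (3 *\<^sub>R x l + x j) = (1 - 1/4) *\<^sub>R x l + (1/4) *\<^sub>R x j"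
        by (simp add: algebra_simps)
      also have "\<dots> \<in> closed_segment (x l) s" 
        unfolding in_segment 1(2) by (intro exI[of _ "1/4"]) simp
      finally show ?thesis using no_push[OF q(1) bP, of "3/4"] by simp
    qed
  qed
qed

lemma unique_minimizer_extreme:
  fixes g :: "'a::euclidean_space"
  assumes "finite S" "a \<in> S" "\<And>s. s \<in> S \<Longrightarrow> s \<noteq> a \<Longrightarrow> g \<bullet> a < g \<bullet> s"
  shows "a extreme_point_of convex hull S"
proof -
  have "convex hull (S - {a}) \<subseteq> {y. g \<bullet> a < g \<bullet> y}"
    using assms(3) by (intro hull_minimal) (auto simp: convex_halfspace_gt)
  then have "a \<notin> convex hull (S - {a})" by auto
  then have "a extreme_point_of convex hull (insert a (S - {a}))"
    using assms(1) by (intro extreme_point_of_convex_hull_insert) auto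
  then show ?thesis using assms(2) by (simp add: insert_absorb)
qed

text \<open>
  The functional \<open>c\<close> is the objective with a long path from \<open>x 0\<close>; the functional \<open>g\<close> certifies that
  \<open>x 0\<close> is a vertex. The number of steps is bounded below by the position reached on the chain, and
  the sink lies at or above the level of its last point.
\<close>
lemma monotone_diameter_chain:
  fixes x :: "nat \<Rightarrow> 'a::euclidean_space"
  assumes mono: "\<And>i j. i < j \<Longrightarrow> j \<le> N \<Longrightarrow> c \<bullet> x i < c \<bullet> x j"
    and min: "\<And>i. 0 < i \<Longrightarrow> i \<le> N \<Longrightarrow> g \<bullet> x 0 < g \<bullet> x i"
    and Q: "finite Q" "\<And>q. q \<in> Q \<Longrightarrow> c \<bullet> q = 0 \<and> 0 < g \<bullet> q"
    and short: "\<And>l j. l < j \<Longrightarrow> Suc j \<le> N \<Longrightarrow>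
          \<exists>q\<in>Q. \<exists>q'\<in>Q. q + q' = (x (Suc j) - x j) - (x (Suc l) - x l)"
  shows "enat N \<le> monotone_diameter (convex hull (chain_with_pushes x N Q))"
proof -
  let ?S = "chain_with_pushes x N Q" and ?P = "convex hull (chain_with_pushes x N Q)"
  have vert: "polytope_vertices ?P \<subseteq> ?S"
    by (auto simp: polytope_vertices_def dest: extreme_point_of_convex_hull)
  have le: "g \<bullet> x 0 \<le> g \<bullet> x i" if "i \<le> N" for i
    using min[of i] that by (cases "i = 0") auto
  have start: "x 0 \<in> polytope_vertices ?P"
    unfolding polytope_vertices_def mem_Collect_eq
  proof (rule unique_minimizer_extreme)
    show "finite ?S" using Q(1) by (simp add: chain_with_pushes_def)
    show "x 0 \<in> ?S" by (simp add: chain_with_pushes_def)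
    fix s assume "s \<in> ?S" "s \<noteq> x 0"
    then consider i where "i \<le> N" "0 < i" "s = x i" | i q where "i \<le> N" "q \<in> Q" "s = x i + q"
      unfolding chain_with_pushes_def by auto
    then show "g \<bullet> x 0 < g \<bullet> s"
    proof cases
      case 2
      then show ?thesis using le[of i] Q(2)[of q] by (simp add: inner_add_right)
    qed (simp add: min)
  qed
  have walk: "\<exists>m\<le>N. m \<le> k \<and> w = x m" if "(x 0, w) \<in> induced_orientation ?P c ^^ k" for k w
    using that
  proof (induction k arbitrary: w)
    case (Suc k)
    then obtain v where v: "(x 0, v) \<in> induced_orientation ?P c ^^ k"
      and vw: "(v, w) \<in> induced_orientation ?P c" by auto
    obtain m where m: "m \<le> N" "m \<le> k" "v = x m" using Suc.IH[OF v] by blast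
    have w: "w \<in> ?S" "c \<bullet> x m < c \<bullet> w" "closed_segment (x m) w edge_of ?P"
      using vw vert m(3) by (auto simp: induced_orientation_def polytope_graph_def)
    have "Suc m \<le> N \<and> w = x (Suc m)"
      using improving_edge_is_next_step[OF mono _ short m(1) w] Q(2) by fastforce
    then show ?case using m(2) by auto
  qed auto
  have "enat N \<le> monotone_distance ?P c (x 0)"
    unfolding monotone_distance_def
  proof (rule INF_greatest, clarify)
    fix k w assume w: "w \<in> sinks ?P c" "(x 0, w) \<in> induced_orientation ?P c ^^ k"
    obtain m where m: "m \<le> N" "m \<le> k" "w = x m" using walk[OF w(2)] by blast
    have "x N \<in> ?P" by (auto intro!: hull_inc simp: chain_with_pushes_def)
    then have "c \<bullet> x N \<le> c \<bullet> x m" using w(1) m(3) by (auto simp: sinks_def)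
    then have "m = N" using mono[of m N] m(1) by (cases "m < N") auto
    then show "enat N \<le> enat k" using m(2) by simp
  qed
  also have "\<dots> \<le> (SUP u \<in> polytope_vertices ?P. monotone_distance ?P c u)"
    using start by (rule SUP_upper)
  also have "\<dots> \<le> monotone_diameter ?P"
    unfolding monotone_diameter_def by (rule SUP_upper) simp
  finally show ?thesis .
qed

section \<open>Binary digits of a number and of its square\<close>

lemma sum_binary_digits:
  "n < 2 ^ m \<Longrightarrow> (\<Sum>k<m. 2 ^ k * (n div 2 ^ k mod 2)) = (n::nat)"
proof (induction m arbitrary: n)
  case (Suc m)
  have "(\<Sum>k<Suc m. 2 ^ k * (n div 2 ^ k mod 2))
      = n mod 2 + 2 * (\<Sum>k<m. 2 ^ k * (n div 2 div 2 ^ k mod 2))"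
    by (subst sum.lessThan_Suc_shift) (simp add: sum_distrib_left div_mult2_eq mult.assoc)
  also have "(\<Sum>k<m. 2 ^ k * (n div 2 div 2 ^ k mod 2)) = n div 2"
    using Suc.prems by (intro Suc.IH) auto
  finally show ?case by simp
qed auto

definition digit :: "nat \<Rightarrow> nat \<Rightarrow> nat \<Rightarrow> int" where
  "digit d i k = int (if k < d then i div 2 ^ k mod 2 else i\<^sup>2 div 2 ^ (k - d) mod 2)"

lemma digit_cases: "digit d i k = 0 \<or> digit d i k = 1"
  unfolding digit_def by auto

definition value_weight :: "nat \<Rightarrow> nat \<Rightarrow> real" where
  "value_weight d k = (if k < d then 2 ^ k else 0)"

definition square_weight :: "nat \<Rightarrow> nat \<Rightarrow> real" where
  "square_weight d k = (if k < d then 0 else 2 ^ (k - d))"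

lemma sum_split_blocks:
  fixes f :: "nat \<Rightarrow> real"
  shows "(\<Sum>k<3 * d. f k) = (\<Sum>k<d. f k) + (\<Sum>k<2 * d. f (k + d))"
proof -
  have "sum f {0 + d..<2 * d + d} = (\<Sum>k<2 * d. f (k + d))"
    unfolding sum.shift_bounds_nat_ivl by (simp add: lessThan_atLeast0)
  then show ?thesis
    using sum.atLeastLessThan_concat[of 0 d "3 * d" f] by (simp add: lessThan_atLeast0)
qed

lemma value_weight_digits:
  assumes "i < 2 ^ d"
  shows "(\<Sum>k<3 * d. value_weight d k * of_int (digit d i k)) = real i"
proof -
  have "(\<Sum>k<d. 2 ^ k * real (i div 2 ^ k mod 2)) = real (\<Sum>k<d. 2 ^ k * (i div 2 ^ k mod 2))"
    by simp
  then show ?thesis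
    using sum_binary_digits[OF assms] by (simp add: sum_split_blocks value_weight_def digit_def)
qed

lemma square_weight_digits:
  assumes "i < 2 ^ d"
  shows "(\<Sum>k<3 * d. square_weight d k * of_int (digit d i k)) = (real i)\<^sup>2"
proof -
  have "i\<^sup>2 < (2 ^ d)\<^sup>2" using assms by (intro power_strict_mono) auto
  then have "i\<^sup>2 < 2 ^ (2 * d)" by (simp add: power_mult mult.commute)
  moreover have "(\<Sum>k<2 * d. 2 ^ k * real (i\<^sup>2 div 2 ^ k mod 2))
      = real (\<Sum>k<2 * d. 2 ^ k * (i\<^sup>2 div 2 ^ k mod 2))"
    by simp
  ultimately show ?thesis
    using sum_binary_digits[of "i\<^sup>2" "2 * d"]
    by (simp add: sum_split_blocks square_weight_def digit_def)
qed

section \<open>Second differences of the digits and their balanced halves\<close>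

definition bend :: "nat \<Rightarrow> nat \<Rightarrow> nat \<Rightarrow> nat \<Rightarrow> int" where
  "bend d i j k = (digit d (Suc j) k - digit d j k) - (digit d (Suc i) k - digit d i k)"

lemma bend_bounds: "- 2 \<le> bend d i j k" "bend d i j k \<le> 2"
  unfolding bend_def
  using digit_cases[of d "Suc j" k] digit_cases[of d j k] digit_cases[of d "Suc i" k]
    digit_cases[of d i k] by auto

lemma sum_weight_bend:
  "(\<Sum>k<m. w k * of_int (bend d i j k))
    = ((\<Sum>k<m. w k * of_int (digit d (Suc j) k)) - (\<Sum>k<m. w k * of_int (digit d j k)))
     - ((\<Sum>k<m. w k * of_int (digit d (Suc i) k)) - (\<Sum>k<m. w k * real_of_int (digit d i k)))"
  by (simp add: bend_def algebra_simps sum.distrib sum_subtractf)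

text \<open>
  The index \<open>(k, b)\<close> stands for copy \<open>b\<close> of digit \<open>k\<close>, and \<open>e\<close> is the copy at which half of the second
  difference is rounded down; at the other copy it is rounded up. Summing over \<open>e\<close> for a fixed copy
  and summing over the copies for a fixed \<open>e\<close> both restore the unrounded value: the first makes the
  two halves add up to the second difference, the second makes every functional that treats the
  copies alike take equal values on them.
\<close>
definition half_bend :: "nat \<Rightarrow> bool \<Rightarrow> nat \<Rightarrow> nat \<Rightarrow> nat \<times> bool \<Rightarrow> int" where
  "half_bend d e i j = (\<lambda>(k, b). if b = e then bend d i j k div 2 else (bend d i j k + 1) div 2)"

lemma half_bend_sum:
  "half_bend d False i j t + half_bend d True i j t = bend d i j (fst t)"
  by (cases t) (auto simp: half_bend_def)

lemma half_bend_copies_sum: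
  "half_bend d e i j (k, False) + half_bend d e i j (k, True) = bend d i j k"
  by (cases e) (auto simp: half_bend_def)

lemma half_bend_bounds: "- 1 \<le> half_bend d e i j t" "half_bend d e i j t \<le> 1"
  using bend_bounds[where d = d and i = i and j = j and k = "fst t"]
  by (auto simp: half_bend_def split: prod.splits)

section \<open>The lattice polytope\<close>

definition vector_at :: "('n \<Rightarrow> 'i) \<Rightarrow> ('i \<Rightarrow> real) \<Rightarrow> real ^ 'n" where
  "vector_at h f = (\<chi> n. f (h n))"

lemma inner_vector_at:
  fixes h :: "'n::finite \<Rightarrow> nat \<times> bool"
  assumes "bij_betw h UNIV ({..<m} \<times> UNIV)"
  shows "vector_at h (\<lambda>t. w (fst t)) \<bullet> vector_at h f = (\<Sum>k<m. w k * (f (k, False) + f (k, True)))"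
proof -
  have "vector_at h (\<lambda>t. w (fst t)) \<bullet> vector_at h f = (\<Sum>n\<in>UNIV. w (fst (h n)) * f (h n))"
    by (simp add: vector_at_def inner_vec_def)
  also have "\<dots> = (\<Sum>t\<in>{..<m} \<times> UNIV. w (fst t) * f t)"
    using sum.reindex_bij_betw[OF assms, of "\<lambda>t. w (fst t) * f t"] .
  also have "\<dots> = (\<Sum>k<m. \<Sum>b\<in>UNIV. w k * f (k, b))"
    by (simp add: sum.cartesian_product case_prod_unfold)
  finally show ?thesis by (simp add: UNIV_bool algebra_simps)
qed

theorem theorem1p1:
  fixes d :: nat
  assumes "d \<ge> 1" and "CARD('n::finite) = 6 * d"
  shows "\<exists>P :: (real ^ 'n) set.
           lattice_polytope P \<and> P \<subseteq> {x. \<forall>i. 0 \<le> x $ i \<and> x $ i \<le> 3} \<and>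
           monotone_diameter P \<ge> enat (2 ^ d - 1)"
proof -
  have "card (UNIV :: 'n set) = card ({..<3 * d} \<times> (UNIV :: bool set))"
    using assms(2) by (simp add: card_cartesian_product)
  then obtain h :: "'n \<Rightarrow> nat \<times> bool" where h: "bij_betw h UNIV ({..<3 * d} \<times> UNIV)"
    using finite_same_card_bij[of "UNIV :: 'n set" "{..<3 * d} \<times> (UNIV :: bool set)"] by auto
  \<comment> \<open>\<open>h\<close> names each coordinate by a digit position and one of its two copies.\<close>
  define N :: nat where "N = 2 ^ d - 1"
  define x :: "nat \<Rightarrow> real ^ 'n" where "x i = vector_at h (\<lambda>t. of_int (1 + digit d i (fst t)))" for i
  define y :: "bool \<Rightarrow> nat \<times> nat \<Rightarrow> real ^ 'n" where
    "y e = (\<lambda>(i, j). vector_at h (\<lambda>t. of_int (half_bend d e i j t)))" for e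
  define Q where "Q = (\<Union>e. y e ` {(i, j). i < j \<and> Suc j \<le> N})"
  define fun_of :: "(nat \<Rightarrow> real) \<Rightarrow> real ^ 'n" where "fun_of w = vector_at h (\<lambda>t. w (fst t))" for w
  define c where "c = fun_of (value_weight d)"
  define g where "g = fun_of (square_weight d)"
  let ?S = "chain_with_pushes x N Q"
  have lt: "i < 2 ^ d" if "i \<le> N" for i
    using that le_less_trans[of i N "2 ^ d"] by (simp add: N_def)
  have inner_x: "fun_of w \<bullet> x i = 2 * (\<Sum>k<3 * d. w k) + 2 * (\<Sum>k<3 * d. w k * of_int (digit d i k))"
    for w i
    unfolding fun_of_def x_def inner_vector_at[OF h]
    by (simp add: algebra_simps sum.distrib sum_distrib_left)
  have inner_y: "fun_of w \<bullet> y e (i, j) = (\<Sum>k<3 * d. w k * of_int (bend d i j k))" for w e i j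
    unfolding fun_of_def y_def prod.case inner_vector_at[OF h] 
    by (simp flip: of_int_add add: half_bend_copies_sum)
  have cx: "c \<bullet> x i = 2 * (\<Sum>k<3 * d. value_weight d k) + 2 * real i" if "i \<le> N" for i
    unfolding c_def inner_x using value_weight_digits lt[OF that] by simp
  have gx: "g \<bullet> x i = 2 * (\<Sum>k<3 * d. square_weight d k) + 2 * (real i)\<^sup>2" if "i \<le> N" for i
    unfolding g_def inner_x using square_weight_digits lt[OF that] by simp
  have cy: "c \<bullet> y e (i, j) = 0" and gy: "g \<bullet> y e (i, j) = 2 * (real j - real i)"
    if "i < j" "Suc j \<le> N" for e i j
    unfolding c_def g_def inner_y sum_weight_bend
    using that by (simp_all add: value_weight_digits square_weight_digits lt)
      (simp add: power2_eq_square algebra_simps)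
  have "finite {(i, j). i < j \<and> Suc j \<le> N}"
    by (rule finite_subset[of _ "{..N} \<times> {..N}"]) auto
  then have finQ: "finite Q" by (auto simp: Q_def)
  have coords: "\<exists>z. s $ n = of_int z \<and> 0 \<le> z \<and> z \<le> 3" if "s \<in> ?S" for s n
  proof -
    have D: "0 \<le> digit d i k" "digit d i k \<le> 1" for i k using digit_cases[of d i k] by auto
    from that consider i where "s = x i" | i e a b where "s = x i + y e (a, b)"
      by (auto simp: chain_with_pushes_def Q_def)
    then show ?thesis
    proof cases
      case 1
      then show ?thesis using D[of i "fst (h n)"]
        by (intro exI[of _ "1 + digit d i (fst (h n))"]) (auto simp: x_def vector_at_def)
    next
      case 2
      then show ?thesis
        using D[of i "fst (h n)"]
          half_bend_bounds[where d = d and e = e and i = a and j = b and t = "h n"]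
        by (intro exI[of _ "1 + digit d i (fst (h n)) + half_bend d e a b (h n)"])
          (auto simp: x_def y_def vector_at_def)
    qed
  qed
  show ?thesis
  proof (intro exI conjI)
    have "finite ?S" using finQ by (simp add: chain_with_pushes_def)
    then have "polytope (convex hull ?S)" by (auto simp: polytope_def)
    moreover have "v $ n \<in> \<int>" if "v extreme_point_of convex hull ?S" for v n
      using coords[OF extreme_point_of_convex_hull[OF that], of n] by auto
    ultimately show "lattice_polytope (convex hull ?S)" by (simp add: lattice_polytope_def)
    have "{z :: real ^ 'n. \<forall>i. 0 \<le> z $ i \<and> z $ i \<le> 3} = cbox 0 (\<chi> i. 3)"
      by (auto simp: mem_box_cart)
    moreover have "0 \<le> s $ n \<and> s $ n \<le> 3" if "s \<in> ?S" for s n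
      using coords[OF that, of n] by auto
    ultimately show "convex hull ?S \<subseteq> {z. \<forall>i. 0 \<le> z $ i \<and> z $ i \<le> 3}"
      by (intro hull_minimal) (auto simp: mem_box_cart)
    have "enat N \<le> monotone_diameter (convex hull ?S)"
    proof (rule monotone_diameter_chain[where c = c and g = g])
      show "c \<bullet> q = 0 \<and> 0 < g \<bullet> q" if "q \<in> Q" for q
        using that cy gy by (auto simp: Q_def)
      show "\<exists>q\<in>Q. \<exists>q'\<in>Q. q + q' = (x (Suc j) - x j) - (x (Suc l) - x l)"
        if "l < j" "Suc j \<le> N" for l j
      proof (intro bexI)
        show "y False (l, j) + y True (l, j) = (x (Suc j) - x j) - (x (Suc l) - x l)"
          by (simp add: vec_eq_iff x_def y_def vector_at_def bend_def half_bend_sum flip: of_int_add)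
        show "y False (l, j) \<in> Q" "y True (l, j) \<in> Q" using that by (auto simp: Q_def)
      qed
    qed (use cx gx finQ in auto)
    then show "enat (2 ^ d - 1) \<le> monotone_diameter (convex hull ?S)" by (simp add: N_def)
  qed
qed

end
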